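(* There are terms $s,t$ of Gödel's system $T$ of lowest level such that $$(\forall\Lambda)\big(\mathsf{WFF}(\Lambda)\to\mathsf{WCF}(t(\Lambda))\big)\wedge(\forall\eta)\big(\mathsf{WCF}(\eta)\to\mathsf{WFF}(s(\eta))\big).$$
   Context: $C=2^{\mathbb N}$ with coin-toss measure $\mathbf m$; $\bar\alpha n=\langle\alpha(0),\dots,\alpha(n-1)\rangle$; $f\in[\sigma]$ means $\bar f|\sigma|=\sigma$; $T\le1$ ranges over binary trees. For a binary tree $T$, $L_n(T)=|\{\sigma\in T:|\sigma|=n\}|/2^n$. $\mathsf{WFF}(\Lambda)$ for $\Lambda$ of type $(2\times0)\to1^*$: for all $G^2$ and $k^0$, $\mathbf m(\{f\in C:(\exists g\in\Lambda(G,k))(f\in[\bar gG(g)])\})\ge1-2^{-k}$. $\mathsf{WCF}(\eta)$, with $\eta(g,k)=(\eta(g,k)(1),\eta(g,k)(2))$ a number and a finite sequence of elements of $C$: $(\forall k^0,g^2,T\le1)\big[(\forall\alpha\in\eta(g,k)(2))(\bar\alpha g(\alpha)\notin T)\to L_{\eta(g,k)(1)}(T)\le 2^{-k}\big]$. *)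

theory Defs
  imports "HOL-Probability.Probability"
begin

section \<open>Goedel's system T with products and finite sequences\<close>

datatype ty = TNat | TFun ty ty (infixr "\<rightarrow>\<^sub>T" 60) | TProd ty ty (infixr "\<times>\<^sub>T" 70) | TSeq ty

definition ty1 :: ty where "ty1 = TNat \<rightarrow>\<^sub>T TNat"
definition ty2 :: ty where "ty2 = ty1 \<rightarrow>\<^sub>T TNat"
definition ty_wff :: ty where "ty_wff = (ty2 \<times>\<^sub>T TNat) \<rightarrow>\<^sub>T TSeq ty1"
definition ty_wcf :: ty where "ty_wcf = (ty2 \<times>\<^sub>T TNat) \<rightarrow>\<^sub>T (TNat \<times>\<^sub>T TSeq ty1)"

text \<open>
  Variables are de Bruijn indices. \<open>TmRec \<rho> a b n\<close> is the recursor of type \<open>\<rho>\<close>. The type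
  \<open>\<rho>\<^sup>*\<close> of finite sequences comes with the length \<open>|s|\<close>, the entries \<open>s(i)\<close>, and the initial
  segments \<open>TmSeg f n = \<langle>f(0), \<dots>, f(n-1)\<rangle>\<close> of functions \<open>f\<close> of type \<open>0 \<rightarrow> \<rho>\<close>; there is no
  recursor along sequences. An entry \<open>s(i)\<close> with \<open>i \<ge> |s|\<close> is the zero object of type \<open>\<rho>\<close>.
\<close>

datatype tm =
    TmVar nat
  | TmLam ty tm
  | TmApp tm tm
  | TmZero
  | TmSuc tm
  | TmRec ty tm tm tm
  | TmPair tm tm
  | TmFst tm
  | TmSnd tm
  | TmLen tm
  | TmNth ty tm tm
  | TmSeg tm tm

inductive typed :: "ty list \<Rightarrow> tm \<Rightarrow> ty \<Rightarrow> bool" where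
  ty_Var: "i < length \<Gamma> \<Longrightarrow> \<Gamma> ! i = \<tau> \<Longrightarrow> typed \<Gamma> (TmVar i) \<tau>"
| ty_Lam: "typed (\<sigma> # \<Gamma>) b \<tau> \<Longrightarrow> typed \<Gamma> (TmLam \<sigma> b) (\<sigma> \<rightarrow>\<^sub>T \<tau>)"
| ty_App: "typed \<Gamma> a (\<sigma> \<rightarrow>\<^sub>T \<tau>) \<Longrightarrow> typed \<Gamma> b \<sigma> \<Longrightarrow> typed \<Gamma> (TmApp a b) \<tau>"
| ty_Zero: "typed \<Gamma> TmZero TNat"
| ty_Suc: "typed \<Gamma> a TNat \<Longrightarrow> typed \<Gamma> (TmSuc a) TNat"
| ty_Rec: "typed \<Gamma> a \<rho> \<Longrightarrow> typed \<Gamma> b (\<rho> \<rightarrow>\<^sub>T TNat \<rightarrow>\<^sub>T \<rho>) \<Longrightarrow> typed \<Gamma> n TNat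
    \<Longrightarrow> typed \<Gamma> (TmRec \<rho> a b n) \<rho>"
| ty_Pair: "typed \<Gamma> a \<sigma> \<Longrightarrow> typed \<Gamma> b \<tau> \<Longrightarrow> typed \<Gamma> (TmPair a b) (\<sigma> \<times>\<^sub>T \<tau>)"
| ty_Fst: "typed \<Gamma> a (\<sigma> \<times>\<^sub>T \<tau>) \<Longrightarrow> typed \<Gamma> (TmFst a) \<sigma>"
| ty_Snd: "typed \<Gamma> a (\<sigma> \<times>\<^sub>T \<tau>) \<Longrightarrow> typed \<Gamma> (TmSnd a) \<tau>"
| ty_Len: "typed \<Gamma> a (TSeq \<rho>) \<Longrightarrow> typed \<Gamma> (TmLen a) TNat"
| ty_Nth: "typed \<Gamma> a (TSeq \<rho>) \<Longrightarrow> typed \<Gamma> i TNat \<Longrightarrow> typed \<Gamma> (TmNth \<rho> a i) \<rho>"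
| ty_Seg: "typed \<Gamma> f (TNat \<rightarrow>\<^sub>T \<rho>) \<Longrightarrow> typed \<Gamma> n TNat \<Longrightarrow> typed \<Gamma> (TmSeg f n) (TSeq \<rho>)"

text \<open>The lowest level of system T: recursion is only available at type \<open>0\<close>.\<close>

primrec lowest_level :: "tm \<Rightarrow> bool" where
  "lowest_level (TmVar i) = True"
| "lowest_level (TmLam \<sigma> b) = lowest_level b"
| "lowest_level (TmApp a b) = (lowest_level a \<and> lowest_level b)"
| "lowest_level TmZero = True"
| "lowest_level (TmSuc a) = lowest_level a"
| "lowest_level (TmRec \<rho> a b n) = (\<rho> = TNat \<and> lowest_level a \<and> lowest_level b \<and> lowest_level n)"
| "lowest_level (TmPair a b) = (lowest_level a \<and> lowest_level b)"
| "lowest_level (TmFst a) = lowest_level a"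
| "lowest_level (TmSnd a) = lowest_level a"
| "lowest_level (TmLen a) = lowest_level a"
| "lowest_level (TmNth \<rho> a i) = (lowest_level a \<and> lowest_level i)"
| "lowest_level (TmSeg f n) = (lowest_level f \<and> lowest_level n)"

definition T0_term :: "tm \<Rightarrow> ty \<Rightarrow> bool" where
  "T0_term t \<tau> \<longleftrightarrow> typed [] t \<tau> \<and> lowest_level t"

primrec zero_tm :: "ty \<Rightarrow> tm" where
  "zero_tm TNat = TmZero"
| "zero_tm (\<sigma> \<rightarrow>\<^sub>T \<tau>) = TmLam \<sigma> (zero_tm \<tau>)"
| "zero_tm (\<sigma> \<times>\<^sub>T \<tau>) = TmPair (zero_tm \<sigma>) (zero_tm \<tau>)"
| "zero_tm (TSeq \<rho>) = TmSeg (TmLam TNat (zero_tm \<rho>)) TmZero"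


section \<open>Values of terms\<close>

type_synonym type1 = "nat \<Rightarrow> nat"
type_synonym type2 = "type1 \<Rightarrow> nat"
type_synonym wff_fun = "type2 \<times> nat \<Rightarrow> type1 list"
type_synonym wcf_fun = "type2 \<times> nat \<Rightarrow> nat \<times> type1 list"

text \<open>
  No single HOL type contains the full type structure over the natural numbers at all finite types,
  so the values of terms are given by evaluation: a value of function type is a closure (a term with
  an environment for its free variables), or an arbitrary set-theoretic functional of one of the
  types \<open>1\<close>, \<open>2\<close>, \<open>(2 \<times> 0) \<rightarrow> 1\<^sup>*\<close>, \<open>(2 \<times> 0) \<rightarrow> 0 \<times> 1\<^sup>*\<close>. Such a functional is applied to a value by
  passing to the function or functional which that value defines on all (set-theoretic) arguments.
\<close>

datatype val =
    VNum nat
  | VPair val val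
  | VSeq "val list"
  | VClo "val list" tm
  | VF1 type1
  | VF2 type2
  | VWff wff_fun
  | VWcf wcf_fun

inductive eval :: "val list \<Rightarrow> tm \<Rightarrow> val \<Rightarrow> bool"
  and apply_val :: "val \<Rightarrow> val \<Rightarrow> val \<Rightarrow> bool"
  and iterate :: "val \<Rightarrow> val \<Rightarrow> nat \<Rightarrow> val \<Rightarrow> bool"
where
  ev_Var: "i < length e \<Longrightarrow> eval e (TmVar i) (e ! i)"
| ev_Lam: "eval e (TmLam \<sigma> b) (VClo e b)"
| ev_App: "eval e a v \<Longrightarrow> eval e b w \<Longrightarrow> apply_val v w r \<Longrightarrow> eval e (TmApp a b) r"
| ev_Zero: "eval e TmZero (VNum 0)"
| ev_Suc: "eval e a (VNum n) \<Longrightarrow> eval e (TmSuc a) (VNum (Suc n))"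
| ev_Rec: "eval e a v \<Longrightarrow> eval e b w \<Longrightarrow> eval e n (VNum m) \<Longrightarrow> iterate v w m r
    \<Longrightarrow> eval e (TmRec \<rho> a b n) r"
| ev_Pair: "eval e a v \<Longrightarrow> eval e b w \<Longrightarrow> eval e (TmPair a b) (VPair v w)"
| ev_Fst: "eval e a (VPair v w) \<Longrightarrow> eval e (TmFst a) v"
| ev_Snd: "eval e a (VPair v w) \<Longrightarrow> eval e (TmSnd a) w"
| ev_Len: "eval e a (VSeq vs) \<Longrightarrow> eval e (TmLen a) (VNum (length vs))"
| ev_Nth: "eval e a (VSeq vs) \<Longrightarrow> eval e i (VNum n) \<Longrightarrow> n < length vs
    \<Longrightarrow> eval e (TmNth \<rho> a i) (vs ! n)"
| ev_Nth_out: "eval e a (VSeq vs) \<Longrightarrow> eval e i (VNum n) \<Longrightarrow> length vs \<le> n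
    \<Longrightarrow> eval [] (zero_tm \<rho>) r \<Longrightarrow> eval e (TmNth \<rho> a i) r"
| ev_Seg: "eval e f v \<Longrightarrow> eval e a (VNum n) \<Longrightarrow> length vs = n
    \<Longrightarrow> (\<And>i. i < n \<Longrightarrow> apply_val v (VNum i) (vs ! i)) \<Longrightarrow> eval e (TmSeg f a) (VSeq vs)"
| ap_Clo: "eval (v # e) b r \<Longrightarrow> apply_val (VClo e b) v r"
| ap_F1: "apply_val (VF1 f) (VNum n) (VNum (f n))"
| ap_F2: "(\<And>n. apply_val v (VNum n) (VNum (f n))) \<Longrightarrow> apply_val (VF2 G) v (VNum (G f))"
| ap_Wff: "(\<And>f. apply_val v (VF1 f) (VNum (G f)))
    \<Longrightarrow> apply_val (VWff \<Lambda>) (VPair v (VNum k)) (VSeq (map VF1 (\<Lambda> (G, k))))"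
| ap_Wcf: "(\<And>f. apply_val v (VF1 f) (VNum (G f))) \<Longrightarrow> \<eta> (G, k) = (n, fs)
    \<Longrightarrow> apply_val (VWcf \<eta>) (VPair v (VNum k)) (VPair (VNum n) (VSeq (map VF1 fs)))"
| it_0: "iterate v w 0 v"
| it_Suc: "iterate v w m r \<Longrightarrow> apply_val w r u \<Longrightarrow> apply_val u (VNum m) r'
    \<Longrightarrow> iterate v w (Suc m) r'"

inductive_cases eval_VarE: "eval e (TmVar i) r"
inductive_cases eval_LamE: "eval e (TmLam \<sigma> b) r"
inductive_cases eval_AppE: "eval e (TmApp a b) r"
inductive_cases eval_ZeroE: "eval e TmZero r"
inductive_cases eval_SucE: "eval e (TmSuc a) r"
inductive_cases eval_RecE: "eval e (TmRec \<rho> a b n) r"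
inductive_cases eval_PairE: "eval e (TmPair a b) r"
inductive_cases eval_FstE: "eval e (TmFst a) r"
inductive_cases eval_SndE: "eval e (TmSnd a) r"
inductive_cases eval_LenE: "eval e (TmLen a) r"
inductive_cases eval_NthE: "eval e (TmNth \<rho> a i) r"
inductive_cases eval_SegE: "eval e (TmSeg f n) r"
inductive_cases apply_CloE: "apply_val (VClo e b) v r"
inductive_cases apply_F1E: "apply_val (VF1 f) v r"
inductive_cases apply_F2E: "apply_val (VF2 G) v r"
inductive_cases apply_WffE: "apply_val (VWff \<Lambda>) v r"
inductive_cases apply_WcfE: "apply_val (VWcf \<eta>) v r"
inductive_cases iterate_0E: "iterate v w 0 r"
inductive_cases iterate_SucE: "iterate v w (Suc m) r"

lemma eval_deterministic:
  "eval e t r \<Longrightarrow> eval e t r1 \<Longrightarrow> r = r1"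
  "apply_val v w r \<Longrightarrow> apply_val v w r1 \<Longrightarrow> r = r1"
  "iterate v w m r \<Longrightarrow> iterate v w m r1 \<Longrightarrow> r = r1"
proof (induction arbitrary: r1 and r1 and r1 rule: eval_apply_val_iterate.inducts)
  case (ev_Var i e) then show ?case by (auto elim: eval_VarE)
next
  case (ev_Lam e \<sigma> b) then show ?case by (auto elim: eval_LamE)
next
  case (ev_App e a v b w r) from ev_App.prems show ?case
    by (rule eval_AppE) (use ev_App.IH in blast)
next
  case (ev_Zero e) then show ?case by (auto elim: eval_ZeroE)
next
  case (ev_Suc e a n) from ev_Suc.prems show ?case
    by (rule eval_SucE) (use ev_Suc.IH in blast)
next
  case (ev_Rec e a v b w n m r \<rho>) from ev_Rec.prems show ?case
    by (rule eval_RecE) (use ev_Rec.IH in blast)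
next
  case (ev_Pair e a v b w) from ev_Pair.prems show ?case
    by (rule eval_PairE) (use ev_Pair.IH in blast)
next
  case (ev_Fst e a v w) from ev_Fst.prems show ?case
    by (rule eval_FstE) (use ev_Fst.IH in blast)
next
  case (ev_Snd e a v w) from ev_Snd.prems show ?case
    by (rule eval_SndE) (use ev_Snd.IH in blast)
next
  case (ev_Len e a vs) from ev_Len.prems show ?case
    by (rule eval_LenE) (use ev_Len.IH in blast)
next
  case (ev_Nth e a vs i n \<rho>) from ev_Nth.prems show ?case
  proof (rule eval_NthE)
    fix vs' n' assume "r1 = vs' ! n'" "eval e a (VSeq vs')" "eval e i (VNum n')"
    then show ?thesis using ev_Nth.IH by blast
  next
    fix vs' n' assume a: "eval e a (VSeq vs')" "eval e i (VNum n')" "length vs' \<le> n'"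
    then have "vs = vs'" "n = n'" using ev_Nth.IH by blast+
    then show ?thesis using a ev_Nth.hyps by simp
  qed
next
  case (ev_Nth_out e a vs i n \<rho> r) from ev_Nth_out.prems show ?case
  proof (rule eval_NthE)
    fix vs' n' assume a: "eval e a (VSeq vs')" "eval e i (VNum n')" "n' < length vs'"
    then have "vs = vs'" "n = n'" using ev_Nth_out.IH by blast+
    then show ?thesis using a ev_Nth_out.hyps by simp
  next
    assume "eval [] (zero_tm \<rho>) r1"
    then show ?thesis using ev_Nth_out.IH by blast
  qed
next
  case (ev_Seg e f v a n vs)
  from ev_Seg.prems show ?case
  proof (rule eval_SegE)
    fix v' n' vs'
    assume a: "r1 = VSeq vs'" "eval e f v'" "eval e a (VNum (length vs'))"
      "\<And>i. i < length vs' \<Longrightarrow> apply_val v' (VNum i) (vs' ! i)"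
    have "v = v'" "n = length vs'" using ev_Seg.IH(1)[OF a(2)] ev_Seg.IH(2)[OF a(3)] by auto
    then have "vs = vs'" using ev_Seg.hyps ev_Seg.IH(3) a(4) by (metis nth_equalityI)
    then show ?thesis using a by simp
  qed
next
  case (ap_Clo v e b r) from ap_Clo.prems show ?case
    by (rule apply_CloE) (use ap_Clo.IH in blast)
next
  case (ap_F1 f n) then show ?case by (auto elim: apply_F1E)
next
  case (ap_F2 v f G) from ap_F2.prems show ?case
  proof (rule apply_F2E)
    fix f' assume a: "r1 = VNum (G f')" "\<And>n. apply_val v (VNum n) (VNum (f' n))"
    have "f = f'" using ap_F2.IH a(2) by blast
    then show ?thesis using a by simp
  qed
next
  case (ap_Wff v G \<Lambda> k) from ap_Wff.prems show ?case
  proof (rule apply_WffE)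
    fix v' G' k'
    assume a: "VPair v (VNum k) = VPair v' (VNum k')" "r1 = VSeq (map VF1 (\<Lambda> (G', k')))"
      "\<And>f. apply_val v' (VF1 f) (VNum (G' f))"
    have "G = G'" using ap_Wff.IH a(1,3) by blast
    then show ?thesis using a by simp
  qed
next
  case (ap_Wcf v G \<eta> k n fs) from ap_Wcf.prems show ?case
  proof (rule apply_WcfE)
    fix v' G' k' n' fs'
    assume a: "VPair v (VNum k) = VPair v' (VNum k')"
      "r1 = VPair (VNum n') (VSeq (map VF1 fs'))"
      "\<And>f. apply_val v' (VF1 f) (VNum (G' f))" "\<eta> (G', k') = (n', fs')"
    have "G = G'" using ap_Wcf.IH a(1,3) by blast
    then show ?thesis using a ap_Wcf.hyps by simp
  qed
next
  case (it_0 v w) then show ?case by (auto elim: iterate_0E)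
next
  case (it_Suc v w m r u r') from it_Suc.prems show ?case
    by (rule iterate_SucE) (use it_Suc.IH in blast)
qed

definition rep1 :: "val \<Rightarrow> type1 \<Rightarrow> bool" where
  "rep1 v f \<longleftrightarrow> (\<forall>n. apply_val v (VNum n) (VNum (f n)))"

definition rep1_seq :: "val \<Rightarrow> type1 list \<Rightarrow> bool" where
  "rep1_seq v fs \<longleftrightarrow> (\<exists>vs. v = VSeq vs \<and> list_all2 rep1 vs fs)"

definition rep_wff :: "val \<Rightarrow> wff_fun \<Rightarrow> bool" where
  "rep_wff v \<Lambda> \<longleftrightarrow>
    (\<forall>G k. \<exists>r. apply_val v (VPair (VF2 G) (VNum k)) r \<and> rep1_seq r (\<Lambda> (G, k)))"

definition rep_wcf :: "val \<Rightarrow> wcf_fun \<Rightarrow> bool" where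
  "rep_wcf v \<eta> \<longleftrightarrow>
    (\<forall>g k. \<exists>r. apply_val v (VPair (VF2 g) (VNum k)) (VPair (VNum (fst (\<eta> (g, k)))) r)
         \<and> rep1_seq r (snd (\<eta> (g, k))))"

text \<open>
  The functional \<open>\<Lambda> \<mapsto> t(\<Lambda>)\<close>, respectively \<open>\<eta> \<mapsto> s(\<eta>)\<close>, given by a closed term. Evaluation is
  deterministic, so there is at most one.
\<close>

definition denotes_wff_to_wcf :: "tm \<Rightarrow> (wff_fun \<Rightarrow> wcf_fun) \<Rightarrow> bool" where
  "denotes_wff_to_wcf t F \<longleftrightarrow>
    (\<exists>v. eval [] t v \<and> (\<forall>\<Lambda>. \<exists>r. apply_val v (VWff \<Lambda>) r \<and> rep_wcf r (F \<Lambda>)))"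

definition denotes_wcf_to_wff :: "tm \<Rightarrow> (wcf_fun \<Rightarrow> wff_fun) \<Rightarrow> bool" where
  "denotes_wcf_to_wff s F \<longleftrightarrow>
    (\<exists>v. eval [] s v \<and> (\<forall>\<eta>. \<exists>r. apply_val v (VWcf \<eta>) r \<and> rep_wff r (F \<eta>)))"

lemma rep1_unique: "rep1 v f \<Longrightarrow> rep1 v f' \<Longrightarrow> f = f'"
  unfolding rep1_def by (rule ext) (use eval_deterministic(2) val.inject(1) in blast)

lemma rep1_seq_unique: "rep1_seq v fs \<Longrightarrow> rep1_seq v fs' \<Longrightarrow> fs = fs'"
  unfolding rep1_seq_def list_all2_conv_all_nth
  by (auto intro!: nth_equalityI) (metis rep1_unique)

lemma rep_wff_unique: "rep_wff v \<Lambda> \<Longrightarrow> rep_wff v \<Lambda>' \<Longrightarrow> \<Lambda> = \<Lambda>'"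
  unfolding rep_wff_def using eval_deterministic(2) rep1_seq_unique
  by (metis ext surj_pair)

lemma rep_wcf_unique:
  assumes "rep_wcf v \<eta>" "rep_wcf v \<eta>'"
  shows "\<eta> = \<eta>'"
proof
  fix x :: "type2 \<times> nat" obtain g k where x: "x = (g, k)" by force
  from assms obtain r r' where
    "apply_val v (VPair (VF2 g) (VNum k)) (VPair (VNum (fst (\<eta> (g, k)))) r)"
    "rep1_seq r (snd (\<eta> (g, k)))"
    "apply_val v (VPair (VF2 g) (VNum k)) (VPair (VNum (fst (\<eta>' (g, k)))) r')"
    "rep1_seq r' (snd (\<eta>' (g, k)))"
    unfolding rep_wcf_def by meson
  then show "\<eta> x = \<eta>' x"
    using eval_deterministic(2) rep1_seq_unique x by (metis prod_eq_iff val.inject(1,2))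
qed

lemma denotes_wff_to_wcf_unique:
  "denotes_wff_to_wcf t F \<Longrightarrow> denotes_wff_to_wcf t F' \<Longrightarrow> F = F'"
  unfolding denotes_wff_to_wcf_def by (metis eval_deterministic(1,2) ext rep_wcf_unique)

lemma denotes_wcf_to_wff_unique:
  "denotes_wcf_to_wff s F \<Longrightarrow> denotes_wcf_to_wff s F' \<Longrightarrow> F = F'"
  unfolding denotes_wcf_to_wff_def by (metis eval_deterministic(1,2) ext rep_wff_unique)


section \<open>Cantor space, binary trees, and the two specifications\<close>

definition Cantor :: "type1 set" where
  "Cantor = {f. \<forall>n. f n \<in> {0, 1}}"

definition coin_measure :: "type1 measure" where
  "coin_measure = PiM UNIV (\<lambda>_. uniform_count_measure {0, 1})"

lemma space_coin_measure: "space coin_measure = Cantor"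
  by (simp add: coin_measure_def Cantor_def space_PiM space_uniform_count_measure PiE_def Pi_def
      del: insert_iff)

definition initial :: "type1 \<Rightarrow> nat \<Rightarrow> nat list" where
  "initial \<alpha> n = map \<alpha> [0..<n]"

definition nbhd :: "nat list \<Rightarrow> type1 set" where
  "nbhd \<sigma> = {f. initial f (length \<sigma>) = \<sigma>}"

definition binary_tree :: "nat list set \<Rightarrow> bool" where
  "binary_tree T \<longleftrightarrow> (\<forall>\<sigma>\<in>T. set \<sigma> \<subseteq> {0, 1}) \<and> (\<forall>\<sigma> \<tau>. \<sigma> @ \<tau> \<in> T \<longrightarrow> \<sigma> \<in> T)"

definition tree_level :: "nat \<Rightarrow> nat list set \<Rightarrow> real" where
  "tree_level n T = real (card {\<sigma> \<in> T. length \<sigma> = n}) / 2 ^ n"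

definition WFF :: "wff_fun \<Rightarrow> bool" where
  "WFF \<Lambda> \<longleftrightarrow>
    (\<forall>G k. measure coin_measure {f \<in> Cantor. \<exists>g\<in>set (\<Lambda> (G, k)). f \<in> nbhd (initial g (G g))}
           \<ge> 1 - 1 / 2 ^ k)"

text \<open>The first conjunct is the type restriction that the second component consists of elements of
  Cantor space, which is not expressed by the HOL type.\<close>

definition WCF :: "wcf_fun \<Rightarrow> bool" where
  "WCF \<eta> \<longleftrightarrow>
    (\<forall>g k. set (snd (\<eta> (g, k))) \<subseteq> Cantor) \<and>
    (\<forall>k g T. binary_tree T \<longrightarrow>
      (\<forall>\<alpha>\<in>set (snd (\<eta> (g, k))). initial \<alpha> (g \<alpha>) \<notin> T) \<longrightarrow>
      tree_level (fst (\<eta> (g, k))) T \<le> 1 / 2 ^ k)"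

end

theory Submission
  imports Defs
begin

text \<open>
  From a weak covering functional \<open>\<eta>\<close>, keep the finite sequence \<open>\<eta>(G,k)(2)\<close> and test it against the
  tree of all binary strings without an initial segment of the form \<open>\<alpha>\<close> up to \<open>G(\<alpha>)\<close>: the
  paths leaving that tree are exactly the covered points. Conversely, apply \<open>\<Lambda>\<close> to
  \<open>G(\<alpha>) = g(sg \<circ> \<alpha>)\<close>, where \<open>sg\<close> truncates values to \<open>{0,1}\<close>, and truncate the resulting
  sequence; entries that are not binary below \<open>G(\<alpha>)\<close> cover nothing, so truncation loses nothing. A
  covered path leaves \<open>T\<close> by the height \<open>\<Sum> g(\<alpha>)\<close>; the sum replaces the maximum since it is
  immediately definable by recursion of type \<open>0\<close>.
\<close>

section \<open>The coin-toss measure of sets determined by initial segments\<close>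

interpretation coin: product_prob_space "\<lambda>_::nat. uniform_count_measure {0::nat, 1}" UNIV
proof -
  interpret prob_space "uniform_count_measure {0::nat, 1}"
    by (rule prob_space_uniform_count_measure) auto
  show "product_prob_space (\<lambda>_::nat. uniform_count_measure {0::nat, 1})"
    by unfold_locales
qed

lemma prob_space_coin_measure: "prob_space coin_measure"
  unfolding coin_measure_def by (rule coin.prob_space_axioms)

lemma length_initial [simp]: "length (initial f n) = n"
  by (simp add: initial_def)

lemma initial_eq_iff: "initial f n = initial g n \<longleftrightarrow> (\<forall>i<n. f i = g i)"
  by (auto simp: initial_def)

lemma take_initial: "m \<le> n \<Longrightarrow> take m (initial f n) = initial f m"
  by (simp add: initial_def take_map)

lemma set_initial_Cantor: "f \<in> Cantor \<Longrightarrow> set (initial f n) \<subseteq> {0, 1}"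
  by (simp add: initial_def Cantor_def image_subset_iff del: insert_iff)

text \<open>A cylinder is a box with singleton sides in the first \<open>n\<close> coordinates, the
  form to which \<open>coin.measure_PiM_emb\<close> applies.\<close>

lemma cylinder_eq_emb:
  "length \<sigma> = n \<Longrightarrow> {f \<in> Cantor. initial f n = \<sigma>} =
    prod_emb UNIV (\<lambda>_::nat. uniform_count_measure {0::nat, 1}) {..<n} (PiE {..<n} (\<lambda>i. {\<sigma> ! i}))"
  by (auto simp: prod_emb_def Cantor_def initial_def list_eq_iff_nth_eq PiE_def Pi_def
      space_uniform_count_measure)

text \<open>Each of the \<open>n\<close> entries is one of two equally likely values, so it
  contributes a factor 1/2.\<close>

lemma
  assumes "length \<sigma> = n" "set \<sigma> \<subseteq> {0, 1}"
  shows sets_cylinder: "{f \<in> Cantor. initial f n = \<sigma>} \<in> sets coin_measure"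
    and measure_cylinder: "measure coin_measure {f \<in> Cantor. initial f n = \<sigma>} = 1 / 2 ^ n"
proof -
  have *: "\<sigma> ! i \<in> {0, 1}" if "i < n" for i
    using assms that nth_mem by blast
  then show "{f \<in> Cantor. initial f n = \<sigma>} \<in> sets coin_measure"
    unfolding cylinder_eq_emb[OF assms(1)] coin_measure_def
    by (intro sets_PiM_I) (auto simp: sets_uniform_count_measure)
  have "measure coin_measure {f \<in> Cantor. initial f n = \<sigma>} =
      (\<Prod>i<n. measure (uniform_count_measure {0::nat, 1}) {\<sigma> ! i})"
    unfolding cylinder_eq_emb[OF assms(1)] coin_measure_def
    using * by (intro coin.measure_PiM_emb) (auto simp: sets_uniform_count_measure)
  also have "\<dots> = (\<Prod>i<n. 1 / 2)"
    using * by (intro prod.cong refl) (subst measure_uniform_count_measure, auto)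
  finally show "measure coin_measure {f \<in> Cantor. initial f n = \<sigma>} = 1 / 2 ^ n"
    by (simp add: power_divide)
qed

text \<open>Only finitely many binary strings have length \<open>n\<close>, and their cylinders are
  disjoint, each of measure \<open>1 / 2 ^ n\<close>.\<close>

lemma
  assumes "\<And>\<sigma>. \<sigma> \<in> T \<Longrightarrow> set \<sigma> \<subseteq> {0, 1}"
  shows sets_initial_mem: "{f \<in> Cantor. initial f n \<in> T} \<in> sets coin_measure"
    and measure_initial_mem: "measure coin_measure {f \<in> Cantor. initial f n \<in> T} = tree_level n T"
proof -
  interpret prob_space coin_measure by (rule prob_space_coin_measure)
  define A where "A = {\<sigma> \<in> T. length \<sigma> = n}"
  define C where "C \<sigma> = {f \<in> Cantor. initial f n = \<sigma>}" for \<sigma>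
  have "A \<subseteq> {\<sigma>. set \<sigma> \<subseteq> {0, 1} \<and> length \<sigma> = n}"
    using assms by (auto simp: A_def)
  then have fin: "finite A"
    by (rule finite_subset) (simp add: finite_lists_length_eq)
  have eq: "{f \<in> Cantor. initial f n \<in> T} = (\<Union>\<sigma>\<in>A. C \<sigma>)"
    by (auto simp: A_def C_def)
  have C: "C \<sigma> \<in> sets coin_measure" "measure coin_measure (C \<sigma>) = 1 / 2 ^ n" if "\<sigma> \<in> A" for \<sigma>
    using that assms sets_cylinder measure_cylinder by (auto simp: A_def C_def)
  show "{f \<in> Cantor. initial f n \<in> T} \<in> sets coin_measure"
    unfolding eq using fin C(1) by (intro sets.finite_UN) auto
  have "measure coin_measure (\<Union>\<sigma>\<in>A. C \<sigma>) = (\<Sum>\<sigma>\<in>A. measure coin_measure (C \<sigma>))"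
    using fin C(1) by (intro finite_measure_finite_Union) (auto simp: C_def disjoint_family_on_def)
  also have "\<dots> = tree_level n T"
    using C(2) by (simp add: tree_level_def A_def)
  finally show "measure coin_measure {f \<in> Cantor. initial f n \<in> T} = tree_level n T"
    by (simp add: eq)
qed

lemma
  assumes "\<And>\<sigma>. \<sigma> \<in> T \<Longrightarrow> set \<sigma> \<subseteq> {0, 1}"
  shows sets_initial_notin: "{f \<in> Cantor. initial f n \<notin> T} \<in> sets coin_measure"
    and measure_initial_notin:
      "measure coin_measure {f \<in> Cantor. initial f n \<notin> T} = 1 - tree_level n T"
proof -
  interpret prob_space coin_measure by (rule prob_space_coin_measure)
  have eq: "{f \<in> Cantor. initial f n \<notin> T} =
      space coin_measure - {f \<in> Cantor. initial f n \<in> T}"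
    by (auto simp: space_coin_measure)
  show "{f \<in> Cantor. initial f n \<notin> T} \<in> sets coin_measure"
    unfolding eq using sets_initial_mem[OF assms] by auto
  show "measure coin_measure {f \<in> Cantor. initial f n \<notin> T} = 1 - tree_level n T"
    unfolding eq using sets_initial_mem[OF assms] measure_initial_mem[OF assms]
    by (simp add: prob_compl)
qed

section \<open>Points covered by a finite sequence\<close>

definition covered :: "type2 \<Rightarrow> type1 list \<Rightarrow> type1 set" where
  "covered G fs = {f \<in> Cantor. \<exists>g\<in>set fs. f \<in> nbhd (initial g (G g))}"

lemma covered_iff:
  "f \<in> covered G fs \<longleftrightarrow> f \<in> Cantor \<and> (\<exists>g\<in>set fs. initial f (G g) = initial g (G g))"
  by (auto simp: covered_def nbhd_def)

text \<open>The entries of \<open>fs\<close> range over all of type 1: a binary segment contributes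
  a cylinder, any other segment the empty set.\<close>

lemma sets_covered: "covered G fs \<in> sets coin_measure"
proof -
  have "{f \<in> Cantor. initial f n = initial g n} \<in> sets coin_measure" for g n
  proof (cases "set (initial g n) \<subseteq> {0, 1}")
    case True
    then show ?thesis by (intro sets_cylinder) auto
  next
    case False
    then have "{f \<in> Cantor. initial f n = initial g n} = {}"
      using set_initial_Cantor by (metis (mono_tags, lifting) empty_Collect_eq)
    then show ?thesis by (simp only: sets.empty_sets)
  qed
  then have "(\<Union>g\<in>set fs. {f \<in> Cantor. initial f (G g) = initial g (G g)}) \<in> sets coin_measure"
    by (intro sets.finite_UN) auto
  also have "(\<Union>g\<in>set fs. {f \<in> Cantor. initial f (G g) = initial g (G g)}) = covered G fs"
    by (auto simp: covered_iff)
  finally show ?thesis .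
qed

lemma WFF_iff: "WFF \<Lambda> \<longleftrightarrow> (\<forall>G k. measure coin_measure (covered G (\<Lambda> (G, k))) \<ge> 1 - 1 / 2 ^ k)"
  by (simp add: WFF_def covered_def)


section \<open>The two translations\<close>

definition wcf_to_wff :: "wcf_fun \<Rightarrow> wff_fun" where
  "wcf_to_wff \<eta> = (\<lambda>p. snd (\<eta> p))"

text \<open>The number \<open>n\<close> supplied by \<open>\<eta>\<close> serves only in the proof:
  it is the level at which the paths outside \<open>T\<close> have measure at least
  \<open>1 - 1 / 2 ^ k\<close>.\<close>

lemma WFF_wcf_to_wff:
  assumes "WCF \<eta>"
  shows "WFF (wcf_to_wff \<eta>)"
  unfolding WFF_iff
proof (intro allI)
  fix G k
  interpret prob_space coin_measure by (rule prob_space_coin_measure)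
  define n fs where "n = fst (\<eta> (G, k))" and "fs = snd (\<eta> (G, k))"
  \<comment> \<open>Stated by concatenation, the condition passes to prefixes by associativity. If
    some \<open>G \<alpha>\<close> is 0, then \<open>T\<close> is empty, which
    \<open>binary_tree\<close> permits.\<close>
  define T where "T = {\<sigma>. set \<sigma> \<subseteq> {0, 1} \<and>
    (\<forall>\<alpha>\<in>set fs. \<forall>\<rho>. \<sigma> \<noteq> initial \<alpha> (G \<alpha>) @ \<rho>)}"
  have "binary_tree T"
    by (force simp: binary_tree_def T_def)
  moreover have "\<forall>\<alpha>\<in>set fs. initial \<alpha> (G \<alpha>) \<notin> T"
    by (auto simp: T_def intro: exI[of _ "[]"])
  ultimately have level: "tree_level n T \<le> 1 / 2 ^ k"
    using assms by (auto simp: WCF_def n_def fs_def)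
  have "{f \<in> Cantor. initial f n \<notin> T} \<subseteq> covered G fs"
  proof
    fix f assume "f \<in> {f \<in> Cantor. initial f n \<notin> T}"
    then obtain \<alpha> \<rho> where f: "f \<in> Cantor" "\<alpha> \<in> set fs" "initial f n = initial \<alpha> (G \<alpha>) @ \<rho>"
      using set_initial_Cantor[of f n] by (auto simp: T_def)
    then have "G \<alpha> \<le> n"
      by (metis le_add1 length_append length_initial)
    then have "initial f (G \<alpha>) = initial \<alpha> (G \<alpha>)"
      using f(3) take_initial[of "G \<alpha>" n f] by simp
    with f show "f \<in> covered G fs" by (auto simp: covered_iff)
  qed
  then have "measure coin_measure {f \<in> Cantor. initial f n \<notin> T} \<le> measure coin_measure (covered G fs)"
    by (rule finite_measure_mono) (rule sets_covered)
  moreover have "measure coin_measure {f \<in> Cantor. initial f n \<notin> T} = 1 - tree_level n T"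
    by (rule measure_initial_notin) (simp add: T_def)
  ultimately show "1 - 1 / 2 ^ k \<le> measure coin_measure (covered G (wcf_to_wff \<eta> (G, k)))"
    using level by (simp add: wcf_to_wff_def fs_def)
qed

section \<open>Truncation to Cantor space and the covering functional\<close>

definition binarize :: "type1 \<Rightarrow> type1" where
  "binarize f = (\<lambda>n. if f n = 0 then 0 else 1)"

lemma binarize_in_Cantor: "binarize f \<in> Cantor"
  by (simp add: binarize_def Cantor_def)

text \<open>Agreement with a point of Cantor space forces the values of \<open>\<alpha>\<close>
  below \<open>n\<close> to be 0 or 1, and truncation fixes these.\<close>

lemma initial_binarize:
  assumes "f \<in> Cantor" "initial f n = initial \<alpha> n"
  shows "initial (binarize \<alpha>) n = initial \<alpha> n"
proof -
  have "\<alpha> i \<in> {0, 1}" if "i < n" for i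
    using assms that unfolding initial_eq_iff Cantor_def by (metis mem_Collect_eq)
  then show ?thesis unfolding initial_eq_iff binarize_def by fastforce
qed

text \<open>The sum runs over indices so that its partial sums are the successive values of the
  recursion in \<open>height_tm\<close>.\<close>

definition wff_to_wcf :: "wff_fun \<Rightarrow> wcf_fun" where
  "wff_to_wcf \<Lambda> = (\<lambda>(g, k). let fs = \<Lambda> (g \<circ> binarize, k) in
    (\<Sum>i<length fs. g (binarize (fs ! i)), map binarize fs))"

lemma WCF_wff_to_wcf:
  assumes "WFF \<Lambda>"
  shows "WCF (wff_to_wcf \<Lambda>)"
  unfolding WCF_def
proof (intro conjI allI impI)
  fix g k
  show "set (snd (wff_to_wcf \<Lambda> (g, k))) \<subseteq> Cantor"
    by (auto simp: wff_to_wcf_def Let_def binarize_in_Cantor)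
next
  fix k g T
  interpret prob_space coin_measure by (rule prob_space_coin_measure)
  define fs where "fs = \<Lambda> (g \<circ> binarize, k)"
  define n where "n = (\<Sum>i<length fs. g (binarize (fs ! i)))"
  have wcf: "wff_to_wcf \<Lambda> (g, k) = (n, map binarize fs)"
    by (simp add: wff_to_wcf_def Let_def fs_def n_def)
  assume T: "binary_tree T"
    and avoid: "\<forall>\<alpha>\<in>set (snd (wff_to_wcf \<Lambda> (g, k))). initial \<alpha> (g \<alpha>) \<notin> T"
  have bin: "set \<sigma> \<subseteq> {0, 1}" if "\<sigma> \<in> T" for \<sigma>
    using T that by (simp add: binary_tree_def)
  have "covered (g \<circ> binarize) fs \<subseteq> {f \<in> Cantor. initial f n \<notin> T}"
  proof
    fix f assume "f \<in> covered (g \<circ> binarize) fs"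
    then obtain \<alpha> where f: "f \<in> Cantor" "\<alpha> \<in> set fs"
        "initial f (g (binarize \<alpha>)) = initial \<alpha> (g (binarize \<alpha>))"
      by (auto simp: covered_iff)
    \<comment> \<open>The truncated entry has the same segment as \<open>\<alpha>\<close> up to this
      length, and \<open>avoid\<close> keeps that segment out of \<open>T\<close>.\<close>
    then have "initial f (g (binarize \<alpha>)) \<notin> T"
      using avoid initial_binarize[OF f(1,3)] by (auto simp: wcf)
    moreover have "g (binarize \<alpha>) \<le> n"
      using f(2) unfolding n_def in_set_conv_nth
      by (auto intro!: member_le_sum[of _ _ "\<lambda>i. g (binarize (fs ! i))"])
    \<comment> \<open>By prefix closure, a path that is outside \<open>T\<close> at one level stays
      outside at all later levels.\<close>
    ultimately have "initial f n \<notin> T"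
      using T take_initial unfolding binary_tree_def by (metis append_take_drop_id)
    with f show "f \<in> {f \<in> Cantor. initial f n \<notin> T}" by simp
  qed
  then have "measure coin_measure (covered (g \<circ> binarize) fs) \<le>
      measure coin_measure {f \<in> Cantor. initial f n \<notin> T}"
    using bin by (intro finite_measure_mono sets_initial_notin)
  also have "\<dots> = 1 - tree_level n T"
    using bin by (rule measure_initial_notin)
  finally have "measure coin_measure (covered (g \<circ> binarize) fs) \<le> 1 - tree_level n T" .
  moreover have "1 - 1 / 2 ^ k \<le> measure coin_measure (covered (g \<circ> binarize) fs)"
    using assms by (simp add: WFF_iff fs_def)
  ultimately show "tree_level (fst (wff_to_wcf \<Lambda> (g, k))) T \<le> 1 / 2 ^ k"
    by (simp add: wcf)
qed


section \<open>Terms for the translations\<close>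

definition wcf_to_wff_tm :: tm where
  "wcf_to_wff_tm = TmLam ty_wcf (TmLam (ty2 \<times>\<^sub>T TNat) (TmSnd (TmApp (TmVar 1) (TmVar 0))))"

text \<open>Recursion with the constant step 1 acts as a case distinction between zero and
  successor.\<close>

definition binarize_tm :: tm where
  "binarize_tm = TmLam ty1 (TmLam TNat
    (TmRec TNat TmZero (TmLam TNat (TmLam TNat (TmSuc TmZero))) (TmApp (TmVar 1) (TmVar 0))))"

text \<open>In the step, variable 1 is the running value and variable 0 the counter. Both
  \<open>a\<close> and \<open>b\<close> stand outside the binders and need no shift.\<close>

definition add_tm :: "tm \<Rightarrow> tm \<Rightarrow> tm" where
  "add_tm a b = TmRec TNat a (TmLam TNat (TmLam TNat (TmSuc (TmVar 1)))) b"

text \<open>In the following two terms, variable \<open>0\<close> is the sequence returned by \<open>\<Lambda>\<close> and variable \<open>1\<close> is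
  the pair \<open>(g, k)\<close>.\<close>

definition height_tm :: tm where
  "height_tm = TmRec TNat TmZero
    (TmLam TNat (TmLam TNat (add_tm (TmVar 1)
      (TmApp (TmFst (TmVar 3)) (TmApp binarize_tm (TmNth ty1 (TmVar 2) (TmVar 0)))))))
    (TmLen (TmVar 0))"

definition sequence_tm :: tm where
  "sequence_tm = TmSeg (TmLam TNat (TmApp binarize_tm (TmNth ty1 (TmVar 1) (TmVar 0))))
    (TmLen (TmVar 0))"

text \<open>The inner redex serves as a let: it binds the sequence returned by
  \<open>\<Lambda>\<close> to variable 0 for both components.\<close>

definition wff_to_wcf_tm :: tm where
  "wff_to_wcf_tm = TmLam ty_wff (TmLam (ty2 \<times>\<^sub>T TNat)
    (TmApp (TmLam (TSeq ty1) (TmPair height_tm sequence_tm))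
      (TmApp (TmVar 1)
        (TmPair (TmLam ty1 (TmApp (TmFst (TmVar 1)) (TmApp binarize_tm (TmVar 0))))
          (TmSnd (TmVar 0))))))"

section \<open>Typing and level of the terms\<close>

lemma T0_wcf_to_wff_tm: "T0_term wcf_to_wff_tm (ty_wcf \<rightarrow>\<^sub>T ty_wff)"
  unfolding T0_term_def wcf_to_wff_tm_def ty_wff_def
  by (auto simp: ty_wcf_def intro!: typed.intros)

lemma typed_binarize_tm: "typed \<Gamma> binarize_tm (ty1 \<rightarrow>\<^sub>T ty1)"
  unfolding binarize_tm_def ty1_def
  by (intro ty_Lam ty_Rec ty_Zero ty_Suc) (rule ty_App; rule ty_Var; simp)

lemma typed_add_tm: "typed \<Gamma> a TNat \<Longrightarrow> typed \<Gamma> b TNat \<Longrightarrow> typed \<Gamma> (add_tm a b) TNat"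
  unfolding add_tm_def by (intro ty_Lam ty_Rec ty_Suc ty_Var) auto

lemma typed_height_tm: "typed (TSeq ty1 # (ty2 \<times>\<^sub>T TNat) # \<Gamma>) height_tm TNat"
  unfolding height_tm_def
  by (rule typed.intros typed_add_tm typed_binarize_tm ty_App[where \<sigma> = ty1]
      ty_Fst[where \<tau> = TNat] ty_Len[where \<rho> = ty1] | simp add: ty2_def)+

lemma typed_sequence_tm: "typed (TSeq ty1 # \<Gamma>) sequence_tm (TSeq ty1)"
  unfolding sequence_tm_def
  \<comment> \<open>The argument type of an application and the entry type under a length do not
    occur in the conclusions of their rules, so they are instantiated.\<close>
  by (rule ty_Seg ty_Lam typed_binarize_tm ty_App[where \<sigma> = ty1] ty_Nth ty_Var
      ty_Len[where \<rho> = ty1] | simp)+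

text \<open>All recursors here compute numbers; the sequence itself is built by
  \<open>TmSeg\<close>, so the level stays lowest.\<close>

lemma T0_wff_to_wcf_tm: "T0_term wff_to_wcf_tm (ty_wff \<rightarrow>\<^sub>T ty_wcf)"
proof -
  have "typed [ty1, ty2 \<times>\<^sub>T TNat, ty_wff]
      (TmApp (TmFst (TmVar 1)) (TmApp binarize_tm (TmVar 0))) TNat"
    by (rule ty_App[where \<sigma> = ty1] ty_Fst[where \<tau> = TNat] typed_binarize_tm ty_Var
        | simp add: ty2_def)+
  then have "typed [ty2 \<times>\<^sub>T TNat, ty_wff]
      (TmLam ty1 (TmApp (TmFst (TmVar 1)) (TmApp binarize_tm (TmVar 0)))) ty2"
    unfolding ty2_def by (rule ty_Lam)
  moreover have "typed [ty2 \<times>\<^sub>T TNat, ty_wff] (TmSnd (TmVar 0)) TNat"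
    by (rule ty_Snd, rule ty_Var) auto
  moreover have "typed [ty2 \<times>\<^sub>T TNat, ty_wff] (TmVar 1) ((ty2 \<times>\<^sub>T TNat) \<rightarrow>\<^sub>T TSeq ty1)"
    by (rule ty_Var) (auto simp: ty_wff_def)
  ultimately have "typed [] wff_to_wcf_tm (ty_wff \<rightarrow>\<^sub>T ty_wcf)"
    unfolding wff_to_wcf_tm_def ty_wcf_def
    by (meson ty_Lam ty_App ty_Pair typed_height_tm typed_sequence_tm)
  then show ?thesis
    by (simp add: T0_term_def wff_to_wcf_tm_def height_tm_def sequence_tm_def add_tm_def
        binarize_tm_def)
qed

section \<open>Evaluation of the terms\<close>

lemma rep1_VF1: "rep1 (VF1 f) f"
  by (simp add: rep1_def ap_F1)

text \<open>Any representation of \<open>f\<close> will do as argument; truncated functions arrive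
  as closures.\<close>

lemma apply_VF2: "rep1 v f \<Longrightarrow> apply_val (VF2 G) v (VNum (G f))"
  by (simp add: rep1_def ap_F2)

lemma eval_Var: "i < length e \<Longrightarrow> e ! i = v \<Longrightarrow> eval e (TmVar i) v"
  using ev_Var by blast

lemma rep1_seq_VF1: "rep1_seq (VSeq (map VF1 fs)) fs"
  by (auto simp: rep1_seq_def list_all2_conv_all_nth rep1_VF1)

lemma denotes_wcf_to_wff_tm: "denotes_wcf_to_wff wcf_to_wff_tm wcf_to_wff"
proof -
  have "apply_val (VClo [VWcf \<eta>] (TmSnd (TmApp (TmVar 1) (TmVar 0)))) (VPair (VF2 G) (VNum k))
      (VSeq (map VF1 (snd (\<eta> (G, k)))))" for \<eta> G k
    by (rule ap_Clo, rule ev_Snd, rule ev_App, (rule eval_Var; simp), (rule eval_Var; simp),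
        rule ap_Wcf[OF apply_VF2[OF rep1_VF1]], rule prod.collapse[symmetric])
  then have "rep_wff (VClo [VWcf \<eta>] (TmSnd (TmApp (TmVar 1) (TmVar 0)))) (wcf_to_wff \<eta>)" for \<eta>
    unfolding rep_wff_def wcf_to_wff_def using rep1_seq_VF1 by blast
  then show ?thesis
    unfolding denotes_wcf_to_wff_def wcf_to_wff_tm_def by (blast intro: ev_Lam ap_Clo)
qed

lemma iterate_VNum:
  assumes "\<And>m. m < n \<Longrightarrow> \<exists>u. apply_val w (VNum (x m)) u \<and> apply_val u (VNum m) (VNum (x (Suc m)))"
  shows "iterate (VNum (x 0)) w n (VNum (x n))"
  using assms
proof (induction n)
  case 0
  show ?case by (rule it_0)
next
  case (Suc n)
  then show ?case by (meson it_Suc lessI less_SucI)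
qed

text \<open>The sequence \<open>x\<close> lists the intermediate values, so evaluating a recursion
  amounts to naming \<open>x\<close> and checking one step.\<close>

lemma eval_TmRec:
  assumes "eval e a (VNum (x 0))" "eval e c (VNum n)"
    and "\<And>m. m < n \<Longrightarrow> eval (VNum m # VNum (x m) # e) b (VNum (x (Suc m)))"
  shows "eval e (TmRec TNat a (TmLam TNat (TmLam TNat b)) c) (VNum (x n))"
  using assms(1) ev_Lam assms(2)
  by (rule ev_Rec) (intro iterate_VNum, use assms(3) in \<open>blast intro: ap_Clo ev_Lam\<close>)

text \<open>The value is a closure and not \<open>VF1 (binarize f)\<close>, so it is described only
  through \<open>rep1\<close>.\<close>

lemma eval_binarize_tm:
  assumes "eval e a v" "rep1 v f"
  shows "\<exists>r. eval e (TmApp binarize_tm a) r \<and> rep1 r (binarize f)"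
proof -
  define b where
    "b = TmRec TNat TmZero (TmLam TNat (TmLam TNat (TmSuc TmZero))) (TmApp (TmVar 1) (TmVar 0))"
  have "eval (VNum n # v # e) (TmApp (TmVar 1) (TmVar 0)) (VNum (f n))" for n
    using assms(2) unfolding rep1_def
    by (intro ev_App[where v = v and w = "VNum n"] eval_Var) auto
  then have "eval (VNum n # v # e) b (VNum (binarize f n))" for n
    unfolding b_def binarize_def
    \<comment> \<open>The iterates are 0 at the start and 1 from the first step on; the recursion
      stops at \<open>f n\<close>.\<close>
    by (intro eval_TmRec[where x = "\<lambda>m. if m = 0 then 0 else 1"])
      (auto intro: ev_Zero ev_Suc[OF ev_Zero])
  then have "rep1 (VClo (v # e) b) (binarize f)"
    by (simp add: rep1_def ap_Clo)
  moreover have "eval e (TmApp binarize_tm a) (VClo (v # e) b)"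
    unfolding binarize_tm_def b_def by (rule ev_App[OF ev_Lam assms(1)]) (intro ap_Clo ev_Lam)
  ultimately show ?thesis by blast
qed

lemma eval_add_tm:
  assumes "eval e a (VNum m)" "eval e b (VNum n)"
  shows "eval e (add_tm a b) (VNum (m + n))"
  unfolding add_tm_def
  by (rule eval_TmRec[where x = "\<lambda>n. m + n"]) (use assms in \<open>auto intro!: ev_Suc eval_Var\<close>)

lemma eval_apply_binarize:
  assumes "eval e a v" "rep1 v f" "eval e h (VF2 g)"
  shows "eval e (TmApp h (TmApp binarize_tm a)) (VNum (g (binarize f)))"
  using eval_binarize_tm[OF assms(1,2)] assms(3) by (blast intro: ev_App apply_VF2)

text \<open>Entries are read only below the length, so the default zero object never arises.\<close>

lemma eval_nth:
  assumes "eval e a (VSeq (map VF1 fs))" "eval e b (VNum i)" "i < length fs"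
  shows "eval e (TmNth \<rho> a b) (VF1 (fs ! i))"
  using ev_Nth[OF assms(1,2)] assms(3) by simp

lemma eval_height_tm:
  "eval (VSeq (map VF1 fs) # VPair (VF2 g) c # e) height_tm
    (VNum (\<Sum>i<length fs. g (binarize (fs ! i))))"
  unfolding height_tm_def
proof (rule eval_TmRec[where x = "\<lambda>n. \<Sum>i<n. g (binarize (fs ! i))"])
  let ?e = "VSeq (map VF1 fs) # VPair (VF2 g) c # e"
  show "eval ?e TmZero (VNum (\<Sum>i<0. g (binarize (fs ! i))))"
    by (simp add: ev_Zero)
  show "eval ?e (TmLen (TmVar 0)) (VNum (length fs))"
    using ev_Len[of ?e "TmVar 0" "map VF1 fs"] by (simp add: eval_Var)
  fix m assume "m < length fs"
  \<comment> \<open>The counter and the partial sum come in front, so the sequence becomes variable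
    2 and the pair variable 3.\<close>
  let ?e' = "VNum m # VNum (\<Sum>i<m. g (binarize (fs ! i))) # ?e"
  have "eval ?e' (TmNth ty1 (TmVar 2) (TmVar 0)) (VF1 (fs ! m))"
    using \<open>m < length fs\<close> by (intro eval_nth eval_Var) auto
  moreover have "eval ?e' (TmFst (TmVar 3)) (VF2 g)"
    by (rule ev_Fst[where w = c], rule eval_Var) auto
  ultimately have "eval ?e' (TmApp (TmFst (TmVar 3)) (TmApp binarize_tm (TmNth ty1 (TmVar 2) (TmVar 0))))
      (VNum (g (binarize (fs ! m))))"
    by (intro eval_apply_binarize[OF _ rep1_VF1])
  then show "eval ?e' (add_tm (TmVar 1)
        (TmApp (TmFst (TmVar 3)) (TmApp binarize_tm (TmNth ty1 (TmVar 2) (TmVar 0)))))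
      (VNum (\<Sum>i<Suc m. g (binarize (fs ! i))))"
    unfolding sum.lessThan_Suc by (intro eval_add_tm eval_Var) auto
qed

lemma eval_sequence_tm:
  "\<exists>r. eval (VSeq (map VF1 fs) # e) sequence_tm r \<and> rep1_seq r (map binarize fs)"
proof -
  let ?e = "VSeq (map VF1 fs) # e"
  let ?b = "TmApp binarize_tm (TmNth ty1 (TmVar 1) (TmVar 0))"
  have "\<exists>r. eval (VNum i # ?e) ?b r \<and> rep1 r (binarize (fs ! i))" if "i < length fs" for i
    using that by (intro eval_binarize_tm[OF _ rep1_VF1] eval_nth eval_Var) auto
  \<comment> \<open>\<open>ev_Seg\<close> asks for a list of values, so one closure is chosen for
    each index.\<close>
  then obtain r where r: "\<And>i. i < length fs \<Longrightarrow> eval (VNum i # ?e) ?b (r i)"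
      "\<And>i. i < length fs \<Longrightarrow> rep1 (r i) (binarize (fs ! i))"
    by metis
  have "eval ?e (TmLen (TmVar 0)) (VNum (length fs))"
    using ev_Len[of ?e "TmVar 0" "map VF1 fs"] by (simp add: eval_Var)
  then have "eval ?e sequence_tm (VSeq (map r [0..<length fs]))"
    unfolding sequence_tm_def by (rule ev_Seg[OF ev_Lam]) (use r(1) in \<open>auto intro: ap_Clo\<close>)
  moreover have "rep1_seq (VSeq (map r [0..<length fs])) (map binarize fs)"
    using r(2) by (auto simp: rep1_seq_def list_all2_conv_all_nth)
  ultimately show ?thesis by blast
qed

lemma denotes_wff_to_wcf_tm: "denotes_wff_to_wcf wff_to_wcf_tm wff_to_wcf"
proof -
  define h where "h = TmApp (TmFst (TmVar 1)) (TmApp binarize_tm (TmVar 0))"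
  define b where "b = TmApp (TmLam (TSeq ty1) (TmPair height_tm sequence_tm))
    (TmApp (TmVar 1) (TmPair (TmLam ty1 h) (TmSnd (TmVar 0))))"
  have "rep_wcf (VClo [VWff \<Lambda>] b) (wff_to_wcf \<Lambda>)" for \<Lambda>
    unfolding rep_wcf_def
  proof (intro allI)
    fix g k
    let ?p = "VPair (VF2 g) (VNum k)"
    let ?e = "[?p, VWff \<Lambda>]"
    define fs where "fs = \<Lambda> (g \<circ> binarize, k)"
    \<comment> \<open>\<open>ap_Wff\<close> identifies its argument by the values at all
      \<open>VF1 f\<close>; these show that the closure of \<open>h\<close> stands for
      \<open>g \<circ> binarize\<close>.\<close>
    have "eval (VF1 f # ?e) h (VNum ((g \<circ> binarize) f))" for f
      unfolding h_def comp_apply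
      by (rule eval_apply_binarize[OF _ rep1_VF1], (rule eval_Var; simp),
          rule ev_Fst[where w = "VNum k"], rule eval_Var) auto
    then have "apply_val (VWff \<Lambda>) (VPair (VClo ?e h) (VNum k)) (VSeq (map VF1 fs))"
      unfolding fs_def by (intro ap_Wff ap_Clo)
    moreover have "eval ?e (TmPair (TmLam ty1 h) (TmSnd (TmVar 0))) (VPair (VClo ?e h) (VNum k))"
      by (rule ev_Pair[OF ev_Lam], rule ev_Snd[where v = "VF2 g"], rule eval_Var) auto
    moreover have "eval ?e (TmVar 1) (VWff \<Lambda>)"
      by (rule eval_Var) auto
    ultimately have "eval ?e (TmApp (TmVar 1) (TmPair (TmLam ty1 h) (TmSnd (TmVar 0))))
        (VSeq (map VF1 fs))"
      by (blast intro: ev_App)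
    moreover obtain r where r: "eval (VSeq (map VF1 fs) # ?e) sequence_tm r"
        "rep1_seq r (map binarize fs)"
      using eval_sequence_tm by blast
    ultimately have "apply_val (VClo [VWff \<Lambda>] b) ?p
        (VPair (VNum (\<Sum>i<length fs. g (binarize (fs ! i)))) r)"
      unfolding b_def by (blast intro: ap_Clo ev_App ev_Lam ev_Pair eval_height_tm)
    with r(2) show "\<exists>r. apply_val (VClo [VWff \<Lambda>] b) ?p
          (VPair (VNum (fst (wff_to_wcf \<Lambda> (g, k)))) r) \<and>
        rep1_seq r (snd (wff_to_wcf \<Lambda> (g, k)))"
      by (auto simp: wff_to_wcf_def Let_def fs_def)
  qed
  then show ?thesis
    unfolding denotes_wff_to_wcf_def wff_to_wcf_tm_def b_def h_def by (blast intro: ev_Lam ap_Clo)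
qed

theorem theorem2p26:
  shows "\<exists>s t S F.
    T0_term s (ty_wcf \<rightarrow>\<^sub>T ty_wff) \<and> denotes_wcf_to_wff s S \<and>
    T0_term t (ty_wff \<rightarrow>\<^sub>T ty_wcf) \<and> denotes_wff_to_wcf t F \<and>
    (\<forall>\<Lambda>. WFF \<Lambda> \<longrightarrow> WCF (F \<Lambda>)) \<and> (\<forall>\<eta>. WCF \<eta> \<longrightarrow> WFF (S \<eta>))"
  using T0_wcf_to_wff_tm denotes_wcf_to_wff_tm T0_wff_to_wcf_tm denotes_wff_to_wcf_tm
    WCF_wff_to_wcf WFF_wcf_to_wff by blast

end
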